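(* Let $n,B_1,B_2$ be positive integers with $n-B_1\ge B_2\ge B_1$, and let $f_j=1/j$ for $j\in[n]$. Let $h:[n]\setminus[B_1]\to[B_2]$ and $s:[n]\to\{-1,1\}$ be independent, truly (uniformly) random functions. For $i\in[n]\setminus[B_1]$ define $\tilde f_i=\sum_{j=B_1+1}^n[h(j)=h(i)]\,s(j)f_j$. Then for every $i\in[n]\setminus[B_1]$, $$\mathbb{E}[|\tilde f_i-s(i)f_i|]=\Theta\left(\frac{\log\frac{B_2+B_1}{B_1}}{B_2}\right),$$ with absolute implied constants.
   Context: $[E]$ denotes the indicator of the event $E$; $[m]=\{1,\dots,m\}$.
   Formalization: The lower bound excludes the single case n=2, B_1=B_2=1 (so i=2), where the estimate is exact and the expected error is 0 although log 2 > 0; the upper bound is proved in all cases. *)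

theory Defs
  imports "HOL-Probability.Probability"
begin

definition zipf :: "nat \<Rightarrow> real" where
  "zipf j = 1 / real j"

definition random_hash :: "nat \<Rightarrow> nat \<Rightarrow> nat \<Rightarrow> (nat \<Rightarrow> nat) pmf" where
  "random_hash n B1 B2 = pmf_of_set (({1..n} - {1..B1}) \<rightarrow>\<^sub>E {1..B2})"

definition random_sign :: "nat \<Rightarrow> (nat \<Rightarrow> real) pmf" where
  "random_sign n = pmf_of_set ({1..n} \<rightarrow>\<^sub>E {-1, 1})"

definition estimate :: "nat \<Rightarrow> nat \<Rightarrow> (nat \<Rightarrow> nat) \<Rightarrow> (nat \<Rightarrow> real) \<Rightarrow> nat \<Rightarrow> real" where
  "estimate n B1 h s i = (\<Sum>j = B1 + 1..n. of_bool (h j = h i) * s j * zipf j)"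

definition expected_error :: "nat \<Rightarrow> nat \<Rightarrow> nat \<Rightarrow> nat \<Rightarrow> real" where
  "expected_error n B1 B2 i =
     measure_pmf.expectation (pair_pmf (random_hash n B1 B2) (random_sign n))
       (\<lambda>(h, s). \<bar>estimate n B1 h s i - s i * zipf i\<bar>)"

text \<open>
  For \<open>n = 2\<close>, \<open>B1 = B2 = 1\<close> the only admissible index is \<open>i = 2\<close>, nothing else can collide
  with it, and the error is identically zero; a positive lower bound fails for this
  single choice of parameters.
\<close>

lemma expected_error_degenerate: "expected_error 2 1 1 2 = 0"
proof -
  have "(\<lambda>(h, s). \<bar>estimate 2 1 h s 2 - s 2 * zipf 2\<bar>) = (\<lambda>_. 0)"
    by (auto simp: estimate_def fun_eq_iff numeral_2_eq_2)
  then show ?thesis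
    by (simp add: expected_error_def)
qed

end

(* Let X be the sum of s(j)/j over the j other than i that collide with i, let J be the block
  of indices j in B1+1..B1+B2 other than i, and let L = ln((B1+B2)/B1).

  Upper bound: the part of X in J is bounded by the triangle inequality, which gives
  (1/B2) sum_J 1/j <= L/B2. The rest Y has second moment at most 1/B2^2, so E|Y| <= 1/B2
  by |Y| <= (B2 Y^2 + 1/B2)/2; and 1 <= L/ln 2 since B2 >= B1.

  Lower bound: given h, the mean of |X| over the signs is at least 1/j for each colliding j,
  since flipping s(j) alone averages to at least that. For B2 >= 2, apply this on the
  disjoint events that j is the only element of J colliding with i, each of
  probability at least 1/(3 B2). For B2 = 1 a single j suffices. *)

theory Submission
  imports Defs
begin


section \<open>Expectations over uniform distributions on finite sets\<close>

lemma expectation_pair_pmf_of_set: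
  fixes f :: "'a \<times> 'b \<Rightarrow> real"
  assumes "finite A" "A \<noteq> {}" "finite B" "B \<noteq> {}"
  shows "measure_pmf.expectation (pair_pmf (pmf_of_set A) (pmf_of_set B)) f =
    measure_pmf.expectation (pmf_of_set A)
      (\<lambda>x. measure_pmf.expectation (pmf_of_set B) (\<lambda>y. f (x, y)))"
proof -
  have "pair_pmf (pmf_of_set A) (pmf_of_set B) = pmf_of_set (A \<times> B)"
    using assms
    by (intro pmf_eqI) (clarsimp simp: pmf_pair pmf_of_set indicator_def card_cartesian_product)
  then show ?thesis
    using assms
    by (simp add: integral_pmf_of_set card_cartesian_product sum.cartesian_product'
        sum_divide_distrib mult.commute)
qed

lemma expectation_pmf_of_set_mono:
  fixes f g :: "'a \<Rightarrow> real"
  assumes "finite A" "A \<noteq> {}" "\<And>x. x \<in> A \<Longrightarrow> f x \<le> g x"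
  shows "measure_pmf.expectation (pmf_of_set A) f \<le> measure_pmf.expectation (pmf_of_set A) g"
  using assms by (auto simp: integral_pmf_of_set intro!: divide_right_mono sum_mono)

lemma expectation_pmf_of_set_sum_cmult:
  fixes f :: "'b \<Rightarrow> 'a \<Rightarrow> real"
  assumes "finite A" "A \<noteq> {}"
  shows "measure_pmf.expectation (pmf_of_set A) (\<lambda>x. \<Sum>j\<in>J. c j * f j x) =
    (\<Sum>j\<in>J. c j * measure_pmf.expectation (pmf_of_set A) (f j))"
  using assms
  by (simp add: integral_pmf_of_set sum_divide_distrib sum_distrib_left) (rule sum.swap)

lemma funcset_finite_nonempty:
  assumes "finite A" "finite R" "R \<noteq> {}"
  shows "finite (A \<rightarrow>\<^sub>E R)" "A \<rightarrow>\<^sub>E R \<noteq> {}"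
  using assms by (auto intro: finite_PiE simp: PiE_eq_empty_iff)

section \<open>Moments of sums with random signs\<close>

lemma expectation_sign_flip:
  fixes f :: "('a \<Rightarrow> real) \<Rightarrow> real"
  assumes "finite A" "k \<in> A"
  shows "measure_pmf.expectation (pmf_of_set (A \<rightarrow>\<^sub>E {-1, 1})) (\<lambda>s. f (s(k := - s k))) =
    measure_pmf.expectation (pmf_of_set (A \<rightarrow>\<^sub>E {-1, 1})) f"
proof -
  let ?S = "A \<rightarrow>\<^sub>E {-1, 1 :: real}"
  have mem: "s(k := - s k) \<in> ?S" if "s \<in> ?S" for s
    using that assms by (auto simp: PiE_def Pi_def extensional_def)
  \<comment> \<open>Negating one coordinate is an involution of the sign cube, so it merely
    reindexes the uniform average.\<close>
  have "bij_betw (\<lambda>s. s(k := - s k)) ?S ?S"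
    by (rule bij_betw_byWitness[where f' = "\<lambda>s. s(k := - s k)"]) (use mem in auto)
  then have "(\<Sum>s\<in>?S. f (s(k := - s k))) = sum f ?S"
    by (rule sum.reindex_bij_betw)
  moreover have "finite ?S" "?S \<noteq> {}"
    using assms by (auto intro: finite_PiE simp: PiE_eq_empty_iff)
  ultimately show ?thesis
    by (simp add: integral_pmf_of_set)
qed

text \<open>Pair \<open>s\<close> with its flip at \<open>k\<close>: with x the term of
  \<open>k\<close> and y the rest, |x + y| + |-x + y| \<ge> 2|x| = 2|a k|. The flip preserves the
  uniform distribution, so both summands have the same mean.\<close>

lemma expectation_abs_signed_sum_ge:
  fixes a :: "'a \<Rightarrow> real"
  assumes "finite A" "J \<subseteq> A" "k \<in> J"
  shows "\<bar>a k\<bar> \<le> measure_pmf.expectation (pmf_of_set (A \<rightarrow>\<^sub>E {-1, 1}))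
    (\<lambda>s. \<bar>\<Sum>j\<in>J. a j * s j\<bar>)"
proof -
  let ?E = "measure_pmf.expectation (pmf_of_set (A \<rightarrow>\<^sub>E {-1, 1 :: real}))"
  let ?f = "\<lambda>s. \<bar>\<Sum>j\<in>J. a j * s j\<bar>"
  note S = funcset_finite_nonempty[OF assms(1), of "{-1, 1 :: real}", simplified]
  have J: "finite J" using assms finite_subset by blast
  have split: "(\<Sum>j\<in>J. a j * s j) = a k * s k + (\<Sum>j\<in>J-{k}. a j * s j)" for s :: "_ \<Rightarrow> real"
    using assms J by (simp add: sum.remove)
  have "2 * \<bar>a k\<bar> \<le> ?f s + ?f (s(k := - s k))" if "s \<in> A \<rightarrow>\<^sub>E {-1, 1}" for s
  proof -
    have "s k = 1 \<or> s k = -1" using that assms by auto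
    moreover have "(\<Sum>j\<in>J-{k}. a j * (s(k := - s k)) j) = (\<Sum>j\<in>J-{k}. a j * s j)"
      by (rule sum.cong) auto
    ultimately show ?thesis unfolding split by auto
  qed
  then have "?E (\<lambda>_. 2 * \<bar>a k\<bar>) \<le> ?E (\<lambda>s. ?f s + ?f (s(k := - s k)))"
    by (intro expectation_pmf_of_set_mono S)
  also have "\<dots> = ?E ?f + ?E (\<lambda>s. ?f (s(k := - s k)))"
    using S by (simp add: integral_pmf_of_set sum.distrib add_divide_distrib)
  also have "?E (\<lambda>s. ?f (s(k := - s k))) = ?E ?f"
    by (rule expectation_sign_flip) (use assms in auto)
  finally show ?thesis by simp
qed

lemma expectation_sign_mult:
  assumes "finite A" "j \<in> A" "k \<in> A"
  shows "measure_pmf.expectation (pmf_of_set (A \<rightarrow>\<^sub>E {-1, 1 :: real})) (\<lambda>s. s j * s k) =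
    of_bool (j = k)"
proof (cases "j = k")
  case True
  note S = funcset_finite_nonempty[OF assms(1), of "{-1, 1 :: real}", simplified]
  have "(\<Sum>s\<in>A \<rightarrow>\<^sub>E {-1, 1 :: real}. s k * s k) = (\<Sum>s\<in>A \<rightarrow>\<^sub>E {-1, 1 :: real}. 1)"
    by (rule sum.cong) (use assms in \<open>auto dest!: PiE_mem[where x = k]\<close>)
  then show ?thesis using True S by (simp add: integral_pmf_of_set)
next
  case False
  \<comment> \<open>Flipping \<open>s j\<close> alone negates the product, so its mean equals its
    own negative.\<close>
  then show ?thesis
    using expectation_sign_flip[OF assms(1,2), of "\<lambda>s. s j * s k"] by simp
qed

text \<open>Distinct signs are orthogonal, so only the diagonal of the expanded square
  survives.\<close>

lemma expectation_signed_sum_square: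
  fixes a :: "'a \<Rightarrow> real"
  assumes "finite A" "J \<subseteq> A"
  shows "measure_pmf.expectation (pmf_of_set (A \<rightarrow>\<^sub>E {-1, 1}))
    (\<lambda>s. (\<Sum>j\<in>J. a j * s j)\<^sup>2) = (\<Sum>j\<in>J. (a j)\<^sup>2)"
proof -
  let ?E = "measure_pmf.expectation (pmf_of_set (A \<rightarrow>\<^sub>E {-1, 1 :: real}))"
  note S = funcset_finite_nonempty[OF assms(1), of "{-1, 1 :: real}", simplified]
  have J: "finite J" using assms finite_subset by blast
  have "(\<lambda>s :: _ \<Rightarrow> real. (\<Sum>j\<in>J. a j * s j)\<^sup>2) =
      (\<lambda>s. \<Sum>(j, k)\<in>J \<times> J. a j * a k * (s j * s k))"
    by (simp add: power2_eq_square sum_product sum.cartesian_product algebra_simps)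
  then have "?E (\<lambda>s. (\<Sum>j\<in>J. a j * s j)\<^sup>2) = (\<Sum>(j, k)\<in>J \<times> J. a j * a k * ?E (\<lambda>s. s j * s k))"
    using expectation_pmf_of_set_sum_cmult[OF S, of "\<lambda>(j, k). a j * a k" "\<lambda>(j, k) s. s j * s k" "J \<times> J"]
    by (simp add: case_prod_unfold)
  also have "\<dots> = (\<Sum>(j, k)\<in>J \<times> J. a j * a k * of_bool (j = k))"
    by (rule sum.cong) (use assms in \<open>auto simp: expectation_sign_mult subset_iff\<close>)
  also have "\<dots> = (\<Sum>j\<in>J. (a j)\<^sup>2)"
    using J by (simp add: of_bool_def if_distrib power2_eq_square cong: if_cong flip: sum.cartesian_product)
  finally show ?thesis .
qed

section \<open>Collision probabilities of the random hash function\<close>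

text \<open>Once the common value b of \<open>h i\<close> and \<open>h j\<close> is fixed, the event
  is a product of conditions on single coordinates and can be counted. It serves twice: with a whole
  block \<open>J\<close> for the lower bound, and with \<open>J = {j}\<close> for the plain
  collision probability.\<close>

lemma hash_isolated_collision:
  fixes R :: "'b set"
  assumes "finite D" "finite R" "R \<noteq> {}" "i \<in> D" "J \<subseteq> D - {i}" "j \<in> J"
  shows "measure_pmf.expectation (pmf_of_set (D \<rightarrow>\<^sub>E R))
      (\<lambda>h. of_bool (h j = h i \<and> (\<forall>k\<in>J-{j}. h k \<noteq> h i))) =
    1 / real (card R) * (1 - 1 / real (card R)) ^ (card J - 1)"
proof -
  let ?m = "card R" and ?H = "D \<rightarrow>\<^sub>E R"
  \<comment> \<open>The box \<open>PiE D (F b)\<close> holds the functions that send i and j to b,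
    avoid b on the rest of \<open>J\<close> and are free elsewhere. The boxes over all b partition
    the event.\<close>
  define F where "F b k = (if k \<in> {i, j} then {b} else if k \<in> J then R - {b} else R)" for b k
  have m: "?m > 0" using assms by (simp add: card_gt_0_iff)
  have H: "finite ?H" "?H \<noteq> {}"
    using assms by (auto intro: finite_PiE simp: PiE_eq_empty_iff)
  have J: "finite J" using assms finite_subset by (metis finite_Diff)
  have set_eq: "{h \<in> ?H. h j = h i \<and> (\<forall>k\<in>J-{j}. h k \<noteq> h i)} = (\<Union>b\<in>R. PiE D (F b))"
  proof (intro equalityI subsetI)
    fix h assume "h \<in> {h \<in> ?H. h j = h i \<and> (\<forall>k\<in>J-{j}. h k \<noteq> h i)}"
    then have "h \<in> PiE D (F (h i))" "h i \<in> R"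
      using assms by (auto simp: F_def PiE_iff)
    then show "h \<in> (\<Union>b\<in>R. PiE D (F b))" by blast
  next
    fix h assume "h \<in> (\<Union>b\<in>R. PiE D (F b))"
    then obtain b where b: "b \<in> R" "h \<in> PiE D (F b)" by blast
    then have val: "h k \<in> F b k" if "k \<in> D" for k using that by auto
    have "h i = b" "h j = b" using val[of i] val[of j] assms by (auto simp: F_def)
    moreover have "h k \<noteq> b" if "k \<in> J - {j}" for k
      using val[of k] that assms by (auto simp: F_def split: if_splits)
    moreover have "h \<in> ?H"
      using b by (auto simp: PiE_iff F_def split: if_splits)
    ultimately show "h \<in> {h \<in> ?H. h j = h i \<and> (\<forall>k\<in>J-{j}. h k \<noteq> h i)}" by auto
  qed
  have cardF: "card (PiE D (F b)) = (?m - 1) ^ (card J - 1) * ?m ^ (card D - card J - 1)"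
    if b: "b \<in> R" for b
  proof -
    \<comment> \<open>Each index contributes a factor 1, m - 1 or m on these three disjoint blocks,
      respectively.\<close>
    have D: "D = {i, j} \<union> (J - {j}) \<union> (D - {i} - J)" using assms by auto
    have "card (PiE D (F b)) = (\<Prod>k\<in>D. card (F b k))"
      using assms by (simp add: card_PiE)
    also have "\<dots> = (\<Prod>k\<in>{i, j}. card (F b k)) * (\<Prod>k\<in>J - {j}. card (F b k)) * (\<Prod>k\<in>D - {i} - J. card (F b k))"
    proof -
      have "prod f D = prod f {i, j} * prod f (J - {j}) * prod f (D - {i} - J)" for f :: "'a \<Rightarrow> nat"
      proof -
        have "prod f D = prod f ({i, j} \<union> (J - {j})) * prod f (D - {i} - J)"
          using assms J by (subst D, intro prod.union_disjoint) auto
        also have "prod f ({i, j} \<union> (J - {j})) = prod f {i, j} * prod f (J - {j})"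
          using assms J by (intro prod.union_disjoint) auto
        finally show ?thesis .
      qed
      then show ?thesis .
    qed
    also have "(\<Prod>k\<in>{i, j}. card (F b k)) = 1"
      by (rule prod.neutral) (auto simp: F_def)
    also have "(\<Prod>k\<in>J - {j}. card (F b k)) = (\<Prod>k\<in>J - {j}. ?m - 1)"
      by (rule prod.cong) (use assms b in \<open>auto simp: F_def\<close>)
    also have "(\<Prod>k\<in>D - {i} - J. card (F b k)) = (\<Prod>k\<in>D - {i} - J. ?m)"
      by (rule prod.cong) (use assms in \<open>auto simp: F_def\<close>)
    finally show ?thesis
      using assms J by (simp add: card_Diff_subset diff_commute)
  qed
  have "card (\<Union>b\<in>R. PiE D (F b)) = (\<Sum>b\<in>R. card (PiE D (F b)))"
  proof (rule card_UN_disjoint)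
    show "\<forall>b\<in>R. finite (PiE D (F b))"
      using assms by (auto intro!: finite_PiE simp: F_def split: if_splits)
    show "\<forall>b\<in>R. \<forall>c\<in>R. b \<noteq> c \<longrightarrow> PiE D (F b) \<inter> PiE D (F c) = {}"
    proof (intro ballI impI equals0I)
      fix b c h assume "b \<noteq> c" "h \<in> PiE D (F b) \<inter> PiE D (F c)"
      then have "h i \<in> F b i" "h i \<in> F c i" using assms by blast+
      with \<open>b \<noteq> c\<close> show False by (simp add: F_def)
    qed
  qed (use assms in auto)
  also have "\<dots> = ?m * ((?m - 1) ^ (card J - 1) * ?m ^ (card D - card J - 1))"
    using cardF by simp
  finally have count: "card {h \<in> ?H. h j = h i \<and> (\<forall>k\<in>J-{j}. h k \<noteq> h i)} = \<dots>"
    using set_eq by simp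
  \<comment> \<open>These inequalities make the truncated subtractions exact. The two
    \<open>Suc\<close> stand for i and j: one factor m cancels against the choice of b, the other
    leaves 1/m.\<close>
  have "card J \<le> card (D - {i})" using assms by (intro card_mono) auto
  moreover have "card D > 0" "card J > 0" using assms J by (auto simp: card_gt_0_iff)
  ultimately have "card D = Suc (card J - 1) + Suc (card D - card J - 1)"
    using assms by (simp add: card_Diff_subset)
  then have cD: "real ?m ^ card D =
      real ?m ^ Suc (card J - 1) * (real ?m * real ?m ^ (card D - card J - 1))"
    by (metis power_add power_Suc)
  have "(\<Sum>h\<in>?H. of_bool (h j = h i \<and> (\<forall>k\<in>J-{j}. h k \<noteq> h i))) =
      real (card {h \<in> ?H. h j = h i \<and> (\<forall>k\<in>J-{j}. h k \<noteq> h i)})"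
    using H by (simp add: Int_def)
  then have "measure_pmf.expectation (pmf_of_set ?H)
      (\<lambda>h. of_bool (h j = h i \<and> (\<forall>k\<in>J-{j}. h k \<noteq> h i))) =
    real ?m * (real (?m - 1) ^ (card J - 1) * real ?m ^ (card D - card J - 1)) / real ?m ^ card D"
    using H count assms by (simp add: integral_pmf_of_set card_PiE)
  also have "\<dots> = (real (?m - 1) / real ?m) ^ (card J - 1) / real ?m"
    using m unfolding cD by (simp add: power_divide field_simps)
  also have "real (?m - 1) / real ?m = 1 - 1 / real ?m"
    using m by (simp add: field_simps of_nat_diff)
  finally show ?thesis by simp
qed

section \<open>Numerical estimates for harmonic sums, their square tails and (1 - 1/m)^k\<close>

lemma sum_recip_le_ln:
  assumes "0 < a"
  shows "(\<Sum>j = a + 1..a + b. 1 / real j) \<le> ln (real (a + b) / real a)"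
proof (induction b)
  case 0
  then show ?case by simp
next
  case (Suc b)
  have "1 / real (a + Suc b) \<le> ln (real (a + Suc b)) - ln (real (a + b))"
    using ln_diff_le[of "real (a + b)" "real (a + Suc b)"] assms
    by (simp add: field_simps)
  with Suc assms show ?case by (simp add: ln_div)
qed

text \<open>The increment ln(x+1) - ln x is at most 1/x; the factor 2 pays for the shift 1/x \<le>
  2/(x+1), valid for x \<ge> 1.\<close>

lemma ln_le_two_sum_recip:
  assumes "0 < a"
  shows "ln (real (a + b) / real a) \<le> 2 * (\<Sum>j = a + 1..a + b. 1 / real j)"
proof (induction b)
  case 0
  then show ?case using assms by simp
next
  case (Suc b)
  have "ln (real (a + Suc b)) - ln (real (a + b)) \<le> 1 / real (a + b)"
    using ln_diff_le[of "real (a + Suc b)" "real (a + b)"] assms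
    by simp
  also have "\<dots> \<le> 2 / real (a + Suc b)"
    using assms by (simp add: field_simps)
  finally show ?case using Suc assms by (simp add: ln_div)
qed

text \<open>The sum telescopes by 1/(x+1)^2 \<le> 1/x - 1/(x+1).\<close>

lemma sum_recip_square_le:
  assumes "0 < a"
  shows "(\<Sum>j = a + 1..n. (1 / real j)\<^sup>2) \<le> 1 / real a"
proof -
  have "(\<Sum>j = a + 1..a + b. (1 / real j)\<^sup>2) \<le> 1 / real a - 1 / real (a + b)" for b
  proof (induction b)
    case (Suc b)
    have "(1 / real (a + Suc b))\<^sup>2 \<le> 1 / (real (a + b) * real (a + Suc b))"
      using assms unfolding power2_eq_square times_divide_times_eq mult_1
      by (intro divide_left_mono mult_right_mono mult_pos_pos) auto
    also have "\<dots> = 1 / real (a + b) - 1 / real (a + Suc b)"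
      using assms by (simp add: field_simps)
    finally show ?case using Suc by simp
  qed simp
  from this[of "n - a"] show ?thesis
    by (cases "a \<le> n") (auto intro: order.trans)
qed

text \<open>The reciprocal of 1 - 1/m is 1 + 1/(m-1), whose power m - 1 is at most e \<le> 3;
  smaller exponents only increase the left-hand power.\<close>

lemma one_minus_recip_power_ge:
  assumes "2 \<le> m" "k \<le> m - 1"
  shows "1 / 3 \<le> (1 - 1 / real m) ^ k"
proof -
  have "(1 + 1 / real (m - 1)) ^ (m - 1) \<le> exp (1 / real (m - 1)) ^ (m - 1)"
    by (intro power_mono exp_ge_add_one_self) auto
  also have "\<dots> = exp 1"
    using assms by (simp flip: exp_of_nat_mult)
  also have "\<dots> \<le> 3" by (rule exp_le)
  finally have "1 / 3 \<le> 1 / (1 + 1 / real (m - 1)) ^ (m - 1)"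
    by (intro divide_left_mono mult_pos_pos zero_less_power add_pos_nonneg) auto
  also have "\<dots> = (1 / (1 + 1 / real (m - 1))) ^ (m - 1)"
    by (rule power_one_over[symmetric])
  also have "1 / (1 + 1 / real (m - 1)) = 1 - 1 / real m"
    using assms by (simp add: of_nat_diff field_simps)
  also have "(1 - 1 / real m) ^ (m - 1) \<le> (1 - 1 / real m) ^ k"
    using assms by (intro power_decreasing) auto
  finally show ?thesis .
qed

section \<open>Error bounds for an arbitrary set \<open>J\<close> of competing indices\<close>

text \<open>Index i always collides with itself, so its term cancels \<open>s i * zipf i\<close>.
  Taking the signs as the inner average leaves, for each fixed h, a signed sum with constant
  coefficients.\<close>

lemma expected_error_eq:
  assumes "i \<in> {1..n} - {1..B1}" "0 < B2"
  shows "expected_error n B1 B2 i = measure_pmf.expectation (random_hash n B1 B2) (\<lambda>h.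
    measure_pmf.expectation (random_sign n) (\<lambda>s.
      \<bar>\<Sum>j\<in>{B1+1..n} - {i}. (zipf j * of_bool (h j = h i)) * s j\<bar>))"
proof -
  have "estimate n B1 h s i - s i * zipf i =
    (\<Sum>j\<in>{B1+1..n} - {i}. (zipf j * of_bool (h j = h i)) * s j)" for h s
    unfolding estimate_def using assms
    by (subst sum.remove[of _ i]) (auto simp: mult_ac intro!: sum.cong)
  then show ?thesis
    using assms
    by (simp add: expected_error_def random_hash_def random_sign_def expectation_pair_pmf_of_set
        funcset_finite_nonempty)
qed

text \<open>For each h at most one member of \<open>J\<close> can be the only one colliding with i,
  so the weighted sum of these indicators is 0 or a single \<open>zipf k\<close>. The sign average
  dominates it in both cases; then average over h.\<close>

lemma expected_error_ge:
  assumes i: "i \<in> {1..n} - {1..B1}" and "0 < B2" and J: "J \<subseteq> {B1+1..n} - {i}"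
  shows "1 / real B2 * (1 - 1 / real B2) ^ (card J - 1) * (\<Sum>j\<in>J. zipf j) \<le>
    expected_error n B1 B2 i"
proof -
  let ?D = "{1..n} - {1..B1}" and ?T = "{B1+1..n} - {i}"
  let ?I = "\<lambda>j h. of_bool (h j = h i \<and> (\<forall>k\<in>J-{j}. h k \<noteq> h i)) :: real"
  have H: "finite (?D \<rightarrow>\<^sub>E {1..B2})" "?D \<rightarrow>\<^sub>E {1..B2} \<noteq> {}"
    using \<open>0 < B2\<close> by (simp_all add: funcset_finite_nonempty)
  have finJ: "finite J" using J finite_subset by blast
  have JD: "J \<subseteq> ?D - {i}" using J by auto
  have bound: "(\<Sum>j\<in>J. zipf j * ?I j h) \<le> measure_pmf.expectation (random_sign n)
      (\<lambda>s. \<bar>\<Sum>j\<in>?T. (zipf j * of_bool (h j = h i)) * s j\<bar>)" for h :: "nat \<Rightarrow> nat"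
  proof (cases "\<exists>k\<in>J. h k = h i \<and> (\<forall>l\<in>J-{k}. h l \<noteq> h i)")
    case True
    then obtain k where k: "k \<in> J" "h k = h i" "\<forall>l\<in>J-{k}. h l \<noteq> h i" by blast
    have "(\<Sum>j\<in>J. zipf j * ?I j h) = (\<Sum>j\<in>J. if j = k then zipf k else 0)"
      by (rule sum.cong) (use k in auto)
    also have "\<dots> = zipf k" using k finJ by simp
    also have "\<dots> = \<bar>zipf k * of_bool (h k = h i)\<bar>" using k by (simp add: zipf_def)
    also have "\<dots> \<le> measure_pmf.expectation (random_sign n)
      (\<lambda>s. \<bar>\<Sum>j\<in>?T. (zipf j * of_bool (h j = h i)) * s j\<bar>)"
      unfolding random_sign_def
      by (rule expectation_abs_signed_sum_ge) (use J k in auto)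
    finally show ?thesis .
  next
    case False
    then have "(\<Sum>j\<in>J. zipf j * ?I j h) = 0" by (intro sum.neutral) auto
    then show ?thesis by simp
  qed
  have "1 / real B2 * (1 - 1 / real B2) ^ (card J - 1) * (\<Sum>j\<in>J. zipf j) =
      (\<Sum>j\<in>J. zipf j * (1 / real B2 * (1 - 1 / real B2) ^ (card J - 1)))"
    by (subst sum_distrib_right[symmetric]) (rule mult.commute)
  also have "\<dots> = (\<Sum>j\<in>J. zipf j * measure_pmf.expectation (random_hash n B1 B2) (?I j))"
    unfolding random_hash_def
    by (intro sum.cong refl arg_cong2[where f = "(*)"])
      (subst hash_isolated_collision, use i JD \<open>0 < B2\<close> in auto)
  also have "\<dots> = measure_pmf.expectation (random_hash n B1 B2) (\<lambda>h. \<Sum>j\<in>J. zipf j * ?I j h)"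
    unfolding random_hash_def by (intro expectation_pmf_of_set_sum_cmult[symmetric] H)
  also have "\<dots> \<le> expected_error n B1 B2 i"
    unfolding expected_error_eq[OF i \<open>0 < B2\<close>] random_hash_def
    by (intro expectation_pmf_of_set_mono H bound)
  finally show ?thesis .
qed

text \<open>Averaging over h turns each collision indicator into 1/B2. Off \<open>J\<close> this
  cancels the weight B2 given to the squares.\<close>

lemma expected_error_le:
  assumes i: "i \<in> {1..n} - {1..B1}" and "0 < B2" and J: "J \<subseteq> {B1+1..n} - {i}"
  shows "expected_error n B1 B2 i \<le> (\<Sum>j\<in>J. zipf j) / real B2 +
    (\<Sum>j\<in>{B1+1..n} - {i} - J. (zipf j)\<^sup>2) / 2 + 1 / (2 * real B2)"
proof -
  let ?D = "{1..n} - {1..B1}" and ?T = "{B1+1..n} - {i}"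
  let ?ES = "measure_pmf.expectation (random_sign n)"
  let ?EH = "measure_pmf.expectation (random_hash n B1 B2)"
  let ?I = "\<lambda>j h. of_bool (h j = h i) :: real"
  have H: "finite (?D \<rightarrow>\<^sub>E {1..B2})" "?D \<rightarrow>\<^sub>E {1..B2} \<noteq> {}"
    using \<open>0 < B2\<close> by (simp_all add: funcset_finite_nonempty)
  have S: "finite ({1..n} \<rightarrow>\<^sub>E {-1, 1 :: real})" "{1..n} \<rightarrow>\<^sub>E {-1, 1 :: real} \<noteq> {}"
    by (simp_all add: funcset_finite_nonempty)
  have finJ: "finite J" using J finite_subset by blast
  \<comment> \<open>For a singleton the isolation condition is vacuous and the exponent is
    0.\<close>
  have coll: "?EH (?I j) = 1 / real B2" if "j \<in> ?T" for j
    using hash_isolated_collision[of ?D "{1..B2}" i "{j}" j] that i \<open>0 < B2\<close>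
    by (auto simp: random_hash_def)
  have bound: "?ES (\<lambda>s. \<bar>\<Sum>j\<in>?T. (zipf j * ?I j h) * s j\<bar>) \<le>
      (\<Sum>j\<in>J. zipf j * ?I j h) + (\<Sum>j\<in>?T - J. (real B2 / 2 * (zipf j)\<^sup>2) * ?I j h) + 1 / (2 * real B2)"
    for h :: "nat \<Rightarrow> nat"
  proof -
    let ?Y = "\<lambda>s. \<Sum>j\<in>?T - J. (zipf j * ?I j h) * s j"
    have "\<bar>\<Sum>j\<in>?T. (zipf j * ?I j h) * s j\<bar> \<le>
        (\<Sum>j\<in>J. zipf j * ?I j h) + 1 / (2 * real B2) + real B2 / 2 * (?Y s)\<^sup>2"
      if s: "s \<in> {1..n} \<rightarrow>\<^sub>E {-1, 1}" for s
    proof -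
      have "(\<Sum>j\<in>?T. (zipf j * ?I j h) * s j) = (\<Sum>j\<in>J. (zipf j * ?I j h) * s j) + ?Y s"
        using J by (simp add: sum.subset_diff add.commute)
      moreover have "\<bar>\<Sum>j\<in>J. (zipf j * ?I j h) * s j\<bar> \<le> (\<Sum>j\<in>J. zipf j * ?I j h)"
      proof (rule order.trans[OF sum_abs sum_mono])
        fix j assume "j \<in> J"
        then have "s j \<in> {-1, 1}" using J by (intro PiE_mem[OF s]) auto
        then show "\<bar>zipf j * ?I j h * s j\<bar> \<le> zipf j * ?I j h"
          by (auto simp: abs_mult zipf_def)
      qed
      moreover have "\<bar>?Y s\<bar> \<le> 1 / (2 * real B2) + real B2 / 2 * (?Y s)\<^sup>2"
      proof -
        \<comment> \<open>The weight B2 balances the two terms when the second moment of Y is of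
          order 1/B2^2.\<close>
        have "0 \<le> (real B2 * \<bar>?Y s\<bar> - 1)\<^sup>2" by simp
        then have "2 * real B2 * \<bar>?Y s\<bar> \<le> 1 + (real B2)\<^sup>2 * (?Y s)\<^sup>2"
          by (simp add: power2_diff power_mult_distrib)
        then show ?thesis
          using \<open>0 < B2\<close> by (simp add: field_simps power2_eq_square)
      qed
      ultimately show ?thesis by linarith
    qed
    then have "?ES (\<lambda>s. \<bar>\<Sum>j\<in>?T. (zipf j * ?I j h) * s j\<bar>) \<le>
      ?ES (\<lambda>s. (\<Sum>j\<in>J. zipf j * ?I j h) + 1 / (2 * real B2) + real B2 / 2 * (?Y s)\<^sup>2)"
      unfolding random_sign_def by (intro expectation_pmf_of_set_mono S)
    also have "\<dots> = (\<Sum>j\<in>J. zipf j * ?I j h) + 1 / (2 * real B2) + real B2 / 2 * ?ES (\<lambda>s. (?Y s)\<^sup>2)"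
      unfolding random_sign_def using S
      by (simp add: integral_pmf_of_set sum.distrib add_divide_distrib
          flip: sum_distrib_left sum_divide_distrib del: One_nat_def)
    also have "?ES (\<lambda>s. (?Y s)\<^sup>2) = (\<Sum>j\<in>?T - J. (zipf j * ?I j h)\<^sup>2)"
      unfolding random_sign_def by (rule expectation_signed_sum_square) auto
    \<comment> \<open>An indicator is its own square, so the bound stays linear in the collision
      indicators.\<close>
    also have "real B2 / 2 * \<dots> = (\<Sum>j\<in>?T - J. (real B2 / 2 * (zipf j)\<^sup>2) * ?I j h)"
      by (auto simp: sum_distrib_left power_mult_distrib power2_eq_square[of "of_bool _"]
          intro!: sum.cong)
    finally show ?thesis by simp
  qed
  have "expected_error n B1 B2 i \<le> ?EH (\<lambda>h. (\<Sum>j\<in>J. zipf j * ?I j h) +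
      (\<Sum>j\<in>?T - J. (real B2 / 2 * (zipf j)\<^sup>2) * ?I j h) + 1 / (2 * real B2))"
    unfolding expected_error_eq[OF i \<open>0 < B2\<close>] unfolding random_hash_def
    by (intro expectation_pmf_of_set_mono H bound)
  also have "\<dots> = ?EH (\<lambda>h. \<Sum>j\<in>J. zipf j * ?I j h) +
      ?EH (\<lambda>h. \<Sum>j\<in>?T - J. (real B2 / 2 * (zipf j)\<^sup>2) * ?I j h) + 1 / (2 * real B2)"
    unfolding random_hash_def using H
    by (simp add: integral_pmf_of_set sum.distrib add_divide_distrib del: One_nat_def)
  also have "?EH (\<lambda>h. \<Sum>j\<in>J. zipf j * ?I j h) = (\<Sum>j\<in>J. zipf j * ?EH (?I j))"
    unfolding random_hash_def by (intro expectation_pmf_of_set_sum_cmult H)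
  also have "\<dots> = (\<Sum>j\<in>J. zipf j * (1 / real B2))"
    using J by (intro sum.cong refl arg_cong2[where f = "(*)"] coll) blast
  also have "?EH (\<lambda>h. \<Sum>j\<in>?T - J. (real B2 / 2 * (zipf j)\<^sup>2) * ?I j h) =
      (\<Sum>j\<in>?T - J. (real B2 / 2 * (zipf j)\<^sup>2) * ?EH (?I j))"
    unfolding random_hash_def by (intro expectation_pmf_of_set_sum_cmult H)
  also have "\<dots> = (\<Sum>j\<in>?T - J. (real B2 / 2 * (zipf j)\<^sup>2) * (1 / real B2))"
    by (intro sum.cong refl arg_cong2[where f = "(*)"] coll) blast
  finally show ?thesis
    using \<open>0 < B2\<close> by (simp add: sum_divide_distrib)
qed

section \<open>Choice of the block and of the constants\<close>

theorem theorem13: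
  "\<exists>c C :: real. 0 < c \<and> 0 < C \<and>
     (\<forall>n B1 B2 i :: nat.
        0 < n \<longrightarrow> 0 < B1 \<longrightarrow> 0 < B2 \<longrightarrow> n - B1 \<ge> B2 \<longrightarrow> B2 \<ge> B1 \<longrightarrow>
        i \<in> {1..n} - {1..B1} \<longrightarrow>
        ((n, B1, B2) \<noteq> (2, 1, 1) \<longrightarrow>
           c * (ln (real (B2 + B1) / real B1) / real B2) \<le> expected_error n B1 B2 i) \<and>
        expected_error n B1 B2 i \<le> C * (ln (real (B2 + B1) / real B1) / real B2))"
proof -
  \<comment> \<open>Here 1/15 = 1/3 * 1/2 * 2/5: the isolation power, the comparison of L with twice
    the harmonic sum, and the loss from removing i from the block. The upper constant comes from L +
    1 with 1 \<le> L / ln 2.\<close>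
  have "(n, B1, B2) \<noteq> (2, 1, 1) \<longrightarrow> 1 / 15 * (L / real B2) \<le> expected_error n B1 B2 i"
    and "expected_error n B1 B2 i \<le> (1 + 1 / ln 2) * (L / real B2)"
    if pos: "0 < B1" "0 < B2" and B: "n - B1 \<ge> B2" "B2 \<ge> B1"
      and i: "i \<in> {1..n} - {1..B1}" and L: "L = ln (real (B2 + B1) / real B1)"
    for n B1 B2 i :: nat and L :: real
  proof -
    define A where "A = {B1 + 1..B1 + B2}"
    define J where "J = A - {i}"
    have J: "J \<subseteq> {B1 + 1..n} - {i}" using B pos by (auto simp: J_def A_def)
    have finJ: "finite J" and nn: "zipf j \<ge> 0" for j by (auto simp: J_def A_def zipf_def)
    have sumA: "(\<Sum>j\<in>A. zipf j) \<le> L" "L \<le> 2 * (\<Sum>j\<in>A. zipf j)"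
      using sum_recip_le_ln[of B1 B2] ln_le_two_sum_recip[of B1 B2] pos L
      by (simp_all add: A_def zipf_def add.commute)
    have "ln 2 \<le> L"
      unfolding L using pos B by (intro iffD2[OF ln_le_cancel_iff]) (auto simp: field_simps)
    then have L1: "1 \<le> 1 / ln 2 * L" by (simp add: field_simps)
    have "(\<Sum>j\<in>J. zipf j) \<le> L"
      using sumA(1) sum_mono2[of A J zipf] nn by (auto simp: J_def A_def)
    moreover have "(\<Sum>j\<in>{B1+1..n} - {i} - J. (zipf j)\<^sup>2) \<le> 1 / real B2"
    proof -
      \<comment> \<open>What remains lies beyond B1 + B2, hence beyond B2.\<close>
      have "(\<Sum>j\<in>{B1+1..n} - {i} - J. (zipf j)\<^sup>2) \<le> (\<Sum>j = B2 + 1..n. (zipf j)\<^sup>2)"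
        by (rule sum_mono2) (auto simp: J_def A_def)
      also have "\<dots> \<le> 1 / real B2"
        using sum_recip_square_le[OF pos(2)] by (simp add: zipf_def)
      finally show ?thesis .
    qed
    ultimately have "expected_error n B1 B2 i \<le> L / real B2 + 1 / real B2 / 2 + 1 / (2 * real B2)"
      using pos
      by (intro order.trans[OF expected_error_le[OF i pos(2) J]] add_mono divide_right_mono) auto
    also have "\<dots> = (L + 1) / real B2" using pos by (simp add: field_simps)
    also have "\<dots> \<le> (L + 1 / ln 2 * L) / real B2"
      using L1 by (intro divide_right_mono) auto
    finally show "expected_error n B1 B2 i \<le> (1 + 1 / ln 2) * (L / real B2)"
      by (simp add: algebra_simps add_divide_distrib)
    show "(n, B1, B2) \<noteq> (2, 1, 1) \<longrightarrow> 1 / 15 * (L / real B2) \<le> expected_error n B1 B2 i"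
    proof (cases "B2 = 1")
      case True
      show ?thesis
      proof
        assume "(n, B1, B2) \<noteq> (2, 1, 1)"
        then have "B1 = 1" "n \<ge> 3" using True pos B by auto
        \<comment> \<open>The block is just {2} here and is lost when i = 2, so a competitor is
          picked from {2, 3}, available since n \<ge> 3. For a singleton the power is 0^0 =
          1.\<close>
        define j :: nat where "j = (if i = 2 then 3 else 2)"
        have "{j} \<subseteq> {B1 + 1..n} - {i}" using \<open>B1 = 1\<close> \<open>n \<ge> 3\<close> by (auto simp: j_def)
        from expected_error_ge[OF i pos(2) this] have "zipf j \<le> expected_error n B1 B2 i"
          using True by simp
        moreover have "1 / 3 \<le> zipf j" by (simp add: j_def zipf_def)
        moreover have "L \<le> 1"
          using True \<open>B1 = 1\<close> ln_le_minus_one[of "2::real"] by (simp add: L)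
        ultimately show "1 / 15 * (L / real B2) \<le> expected_error n B1 B2 i"
          using True by simp
      qed
    next
      case False
      then have B2: "B2 \<ge> 2" using pos by simp
      have "card J \<le> B2"
        using card_mono[of A J] by (simp add: A_def J_def)
      then have p: "1 / 3 \<le> (1 - 1 / real B2) ^ (card J - 1)"
        by (intro one_minus_recip_power_ge B2) simp
      \<comment> \<open>If i lies in the block, its term is at most 3/2 of the largest remaining
        one. The worst case is i = B1 + 1 against B1 + 2, with ratio (B1+2)/(B1+1) \<le> 3/2; B2
        \<ge> 2 keeps the witness k in the block.\<close>
      have "(\<Sum>j\<in>A. zipf j) \<le> 5 / 2 * (\<Sum>j\<in>J. zipf j)"
      proof (cases "i \<in> A")
        case True
        define k where "k = (if i = B1 + 1 then B1 + 2 else B1 + 1)"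
        have k: "k \<in> J" using B2 by (auto simp: k_def J_def A_def)
        have "zipf i \<le> 3 / 2 * zipf k"
          using True pos by (auto simp: zipf_def k_def A_def field_simps)
        also have "zipf k \<le> (\<Sum>j\<in>J. zipf j)"
          using k finJ nn by (intro member_le_sum) auto
        finally show ?thesis
          using True sum.remove[of A i zipf] by (simp add: J_def A_def)
      next
        case False
        then have "J = A" by (auto simp: J_def)
        then show ?thesis using sum_nonneg[of A zipf] nn by simp
      qed
      with sumA(2) have "1 / 15 * L \<le> 1 / 3 * (\<Sum>j\<in>J. zipf j)" by simp
      also have "\<dots> \<le> (1 - 1 / real B2) ^ (card J - 1) * (\<Sum>j\<in>J. zipf j)"
        by (intro mult_right_mono p sum_nonneg nn)
      finally have "1 / 15 * L / real B2 \<le>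
          (1 - 1 / real B2) ^ (card J - 1) * (\<Sum>j\<in>J. zipf j) / real B2"
        by (rule divide_right_mono) simp
      also have "\<dots> \<le> expected_error n B1 B2 i"
        using expected_error_ge[OF i pos(2) J] by simp
      finally show ?thesis by simp
    qed
  qed
  note bounds = this
  show ?thesis
  proof (intro exI conjI allI impI)
    show "(0::real) < 1 / 15" "0 < 1 + 1 / ln (2::real)"
      by (simp_all add: add_pos_pos)
  qed (rule bounds(1)[THEN mp] bounds(2); (assumption | rule refl))+
qed

end
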